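(* Let $s = s(n)$ and $m = m(n)$ be functions of the positive integer $n$, with positive integer values, such that $s(n) \to \infty$, $m(n) \to \infty$ and $s(n)/\sqrt{m(n)} \to \infty$ as $n \to \infty$. Then, as $n \to \infty$, $$\lambda(s, m) \;=\; \binom{m}{2}\, s\,\bigl(1 - o(1)\bigr).$$
   Context: A Davenport--Schinzel sequence of order $s$ over an $m$-letter alphabet is a finite sequence of letters from an alphabet of size $m$ (not every letter has to occur) with no immediate repetitions (no two adjacent terms are equal) and with no alternating subsequence of length $s+2$, i.e. no (not necessarily contiguous) subsequence of the form $a, b, a, b, \ldots$ of length $s+2$ with $a \neq b$. For positive integers $s, m$, $\lambda(s,m)$ denotes the maximum length of a Davenport--Schinzel sequence of order $s$ over an $m$-letter alphabet. Here $o(1)$ denotes a quantity tending to $0$ as $n \to \infty$ (with no sign prescribed), so the conclusion says that $\lambda(s(n),m(n)) / \bigl(\binom{m(n)}{2}\, s(n)\bigr) \to 1$ as $n\to\infty$. *)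

theory Defs
  imports Complex_Main "HOL-Library.Sublist"
begin

definition alternation :: "'a \<Rightarrow> 'a \<Rightarrow> nat \<Rightarrow> 'a list" where
  "alternation a b k = map (\<lambda>i. if even i then a else b) [0..<k]"

definition davenport_schinzel :: "nat \<Rightarrow> 'a set \<Rightarrow> 'a list \<Rightarrow> bool" where
  "davenport_schinzel s A w \<longleftrightarrow>
     set w \<subseteq> A \<and> distinct_adj w \<and>
     (\<forall>a b. a \<noteq> b \<longrightarrow> \<not> subseq (alternation a b (s + 2)) w)"

(* The set of lengths is nonempty (take the empty sequence) and finite: each ordered pair of
   letters can occur in consecutive positions only boundedly often. So Max is the true maximum. *)
definition ds_lambda :: "nat \<Rightarrow> nat \<Rightarrow> nat" where
  "ds_lambda s m = Max {length w | w :: nat list. davenport_schinzel s {..<m} w}"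

end

theory Submission
  imports Defs "HOL-Algebra.Algebraic_Closure_Type" "HOL-Library.Z2"
begin

text \<open>
  Two letters \<open>a\<close> and \<open>b\<close> can occupy few pairs of neighbouring positions: each such pair
  is one switch in the restriction of the word to \<open>{a, b}\<close>, and a word of order \<open>s\<close> allows at
  most \<open>s\<close> switches. Summing over all pairs of letters bounds the length by
  \<open>(m choose 2) * s + 1\<close> (\<open>davenport_schinzel_length_le\<close>).

  The lower bound asks for words that use almost all of this budget for almost every pair. They
  are obtained by concatenating words over small blocks of letters
  (\<open>davenport_schinzel_from_blocks\<close>). If two letters share at most one block and no letter lies in
  more than \<open>r\<close> blocks, then outside the common block each block contributes at most one term to the
  longest alternation of \<open>a\<close> and \<open>b\<close>. So concatenation raises the order only by \<open>2 * r\<close>,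
  while the lengths add up, apart from one term for each junction.

  This construction is applied twice. On an alphabet of \<open>k\<close> letters, all two-element blocks with
  an alternation on each give order \<open>s + 2 * k\<close> and length at least \<open>(k choose 2) * s\<close>, which is good
  once \<open>s\<close> is large compared with \<open>k\<close>. Used directly with \<open>k = m\<close> this would need \<open>s\<close> to outgrow
  \<open>m\<close>. Instead it serves as the inner word on the blocks of a transversal design: for a finite
  field with \<open>q\<close> elements and \<open>k \<le> q\<close>, the lines over the field give \<open>q\<^sup>2\<close> blocks of size \<open>k\<close>
  on \<open>k * q\<close> letters, with \<open>q\<close> blocks through each letter and exactly one block through two letters
  with different first coordinates. For \<open>q\<close> of the size of \<open>sqrt m\<close> and \<open>k = m div q\<close>, the blocks
  have size at most \<open>q\<close>, so the two steps together cost only \<open>2 * k + 2 * q \<le> 4 * q\<close> in the order. That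
  is negligible because \<open>s\<close> outgrows \<open>sqrt m\<close>. The pairs of letters in no common block and the
  letters outside the design are a vanishing proportion as well.

  The design does not need \<open>q\<close> to be close to \<open>sqrt m\<close>, only within a constant factor of it.
  Hence \<open>q\<close> can be a power of two, which avoids any information about gaps between primes; the field
  of that size is cut out of the algebraic closure of the field with two elements.
\<close>

section \<open>Alternations of two letters\<close>

text \<open>
  Since neighbouring letters of a reduced word on \<open>{a, b}\<close> must differ, this is the length
  of the longest alternating subsequence on \<open>a\<close> and \<open>b\<close>, whichever letter it starts with.
\<close>
definition alt_length :: "'a \<Rightarrow> 'a \<Rightarrow> 'a list \<Rightarrow> nat" where
  "alt_length a b w = length (remdups_adj (filter (\<lambda>x. x = a \<or> x = b) w))"

lemma length_remdups_adj_Cons_ge: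
  "length (remdups_adj xs) \<le> length (remdups_adj (x # xs))"
  by (cases xs) auto

lemma length_remdups_adj_Cons_le:
  "length (remdups_adj (x # xs)) \<le> Suc (length (remdups_adj xs))"
  by (cases xs) auto

text \<open>
  Each run of equal letters in \<open>ys\<close> can supply only one term of a subsequence without
  repetitions, so \<open>xs\<close> is no longer than the list of runs.
\<close>
lemma subseq_length_remdups_adj:
  assumes "subseq xs ys" "distinct_adj xs"
  shows "length xs \<le> length (remdups_adj ys)"
  using assms
proof (induction ys arbitrary: xs rule: remdups_adj.induct)
  case (3 x y ys)
  show ?case
  proof (cases "x = y")
    case True
    have "subseq xs (y # ys)"
    proof (cases xs)
      case (Cons z zs)
      show ?thesis
      proof (cases "z = x")
        case zx: True
        then have zs: "subseq zs (y # ys)"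
          using "3.prems"(1) Cons by simp
        have "zs = [] \<or> hd zs \<noteq> y"
          using "3.prems"(2) Cons zx True by (auto simp: distinct_adj_Cons)
        then have "subseq zs ys"
          using zs by (cases zs) (auto simp: subseq_Cons2_neq)
        then show ?thesis using Cons zx True by simp
      qed (use "3.prems"(1) Cons in auto)
    qed simp
    then show ?thesis using "3.IH"(1) "3.prems"(2) True by simp
  next
    case False
    show ?thesis
    proof (cases xs)
      case (Cons z zs)
      have "subseq zs (y # ys)"
        using "3.prems"(1) Cons by (auto dest: subseq_Cons' split: if_splits)
      moreover have "distinct_adj zs"
        using "3.prems"(2) Cons by (auto dest: distinct_adj_ConsD)
      ultimately have "length zs \<le> length (remdups_adj (y # ys))"
        using "3.IH"(2)[OF False] by blast
      then show ?thesis using Cons False by simp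
    qed simp
  qed
qed (auto dest: list_emb_length)

lemma subseq_remdups_adj: "subseq (remdups_adj xs) xs"
  by (induction xs rule: remdups_adj.induct) auto

lemma length_remdups_adj_mono:
  assumes "subseq xs ys"
  shows "length (remdups_adj xs) \<le> length (remdups_adj ys)"
proof -
  have "subseq (remdups_adj xs) ys"
    using subseq_remdups_adj assms by (rule subseq_order.order_trans)
  then show ?thesis by (intro subseq_length_remdups_adj) auto
qed

lemma length_remdups_adj_append_le:
  "length (remdups_adj (xs @ ys)) \<le> length (remdups_adj xs) + length (remdups_adj ys)"
  by (induction xs rule: remdups_adj.induct) (auto intro: length_remdups_adj_Cons_le)

text \<open>
  Only the last run of \<open>xs\<close> and the first run of \<open>ys\<close> can merge.
\<close>
lemma length_remdups_adj_append_ge: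
  "length (remdups_adj xs) + length (remdups_adj ys) \<le> Suc (length (remdups_adj (xs @ ys)))"
proof (induction xs rule: remdups_adj.induct)
  case (2 x)
  show ?case using length_remdups_adj_Cons_ge[of ys x] by simp
qed auto

lemma length_alternation [simp]: "length (alternation a b k) = k"
  by (simp add: alternation_def)

lemma distinct_adj_alternation: "a \<noteq> b \<Longrightarrow> distinct_adj (alternation a b k)"
  by (auto simp: distinct_adj_conv_nth alternation_def)

lemma set_alternation: "set (alternation a b k) \<subseteq> {a, b}"
  by (auto simp: alternation_def)

lemma alternation_Suc: "alternation a b (Suc k) = a # alternation b a k"
  unfolding alternation_def
  by (simp only: upt_conv_Cons[OF zero_less_Suc] map_Suc_upt[symmetric]) (simp add: comp_def)

lemma subseq_alternation_le:
  assumes "subseq (alternation a b k) w" "a \<noteq> b"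
  shows "k \<le> alt_length a b w"
proof -
  have "filter (\<lambda>x. x = a \<or> x = b) (alternation a b k) = alternation a b k"
    using set_alternation[of a b k] by (intro filter_True) auto
  then have "subseq (alternation a b k) (filter (\<lambda>x. x = a \<or> x = b) w)"
    using subseq_filter[OF assms(1), of "\<lambda>x. x = a \<or> x = b"] by simp
  then show ?thesis
    using subseq_length_remdups_adj distinct_adj_alternation[OF assms(2)]
    unfolding alt_length_def by fastforce
qed

lemma distinct_adj_two_letters:
  assumes "distinct_adj xs" "set xs \<subseteq> {a, b}"
  shows "xs = alternation a b (length xs) \<or> xs = alternation b a (length xs)"
  using assms
proof (induction xs)
  case (Cons x xs)
  then have IH: "xs = alternation a b (length xs) \<or> xs = alternation b a (length xs)"
    by (auto dest: distinct_adj_ConsD)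
  show ?case
  proof (cases xs)
    case Nil
    then show ?thesis using Cons.prems by (auto simp: alternation_def)
  next
    case (Cons y ys)
    then have "x \<noteq> y" "x \<in> {a,b}" "y \<in> {a,b}"
      using Cons.prems by auto
    moreover have "xs = alternation y (if y = a then b else a) (length xs)"
      using IH Cons \<open>y \<in> {a,b}\<close> by (auto simp: alternation_Suc)
    ultimately have "x # xs = alternation x y (Suc (length xs))"
      by (auto simp: alternation_Suc split: if_splits)
    then show ?thesis using \<open>x \<noteq> y\<close> \<open>x \<in> {a,b}\<close> \<open>y \<in> {a,b}\<close> by auto
  qed
qed (simp add: alternation_def)

text \<open>
  Forbidding alternations is thus a bound on a quantity that behaves well under subsequences and
  concatenation; both halves of the theorem work with this form.
\<close>
lemma davenport_schinzel_alt_length_iff: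
  "davenport_schinzel s A w \<longleftrightarrow>
     set w \<subseteq> A \<and> distinct_adj w \<and> (\<forall>a b. a \<noteq> b \<longrightarrow> alt_length a b w \<le> s + 1)"
proof -
  have "alt_length a b w \<le> s + 1"
    if no: "\<forall>a b. a \<noteq> b \<longrightarrow> \<not> subseq (alternation a b (s + 2)) w" and "a \<noteq> b" for a b
  proof (rule ccontr)
    define r where "r = remdups_adj (filter (\<lambda>x. x = a \<or> x = b) w)"
    assume "\<not> ?thesis"
    then have len: "s + 2 \<le> length r" by (simp add: alt_length_def r_def)
    \<comment> \<open>A word of runs longer than \<open>s + 1\<close> starts with a forbidden alternation, on \<open>a, b\<close> or on \<open>b, a\<close>.\<close>
    have "subseq r w"
      unfolding r_def using subseq_remdups_adj subseq_filter_left subseq_order.order_trans by blast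
    then have "subseq (take (s + 2) r) w"
      by (meson prefix_imp_subseq subseq_order.order_trans take_is_prefix)
    moreover have "take (s + 2) r = alternation a b (s + 2) \<or> take (s + 2) r = alternation b a (s + 2)"
    proof -
      have "distinct_adj (take (s + 2) r @ drop (s + 2) r)" by (simp add: r_def)
      then have "distinct_adj (take (s + 2) r)" by (rule distinct_adj_appendD1)
      moreover have "set (take (s + 2) r) \<subseteq> {a, b}"
        using set_take_subset[of "s + 2" r] by (auto simp: r_def)
      ultimately show ?thesis
        using distinct_adj_two_letters[of "take (s + 2) r" a b] len
        unfolding length_take min_absorb2[OF len] by blast
    qed
    ultimately show False using no \<open>a \<noteq> b\<close> by metis
  qed
  then show ?thesis
    unfolding davenport_schinzel_def using subseq_alternation_le by fastforce
qed

section \<open>The upper bound\<close>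
definition adjacent_count :: "'a set \<Rightarrow> 'a list \<Rightarrow> nat" where
  "adjacent_count P w = length (filter (\<lambda>(x, y). {x, y} = P) (zip w (tl w)))"

text \<open>
  Every neighbouring occurrence of \<open>a\<close> and \<open>b\<close> is a boundary between two runs of the word
  restricted to \<open>{a, b}\<close>, and there are fewer boundaries than runs. Without such an occurrence
  the restriction may be empty, hence the second assumption.
\<close>
lemma adjacent_count_less_alt_length:
  assumes "distinct_adj w" "adjacent_count {a, b} w > 0"
  shows "adjacent_count {a, b} w < alt_length a b w"
  using assms
proof (induction w)
  case (Cons x w)
  show ?case
  proof (cases w)
    case Nil
    then show ?thesis using Cons.prems by (simp add: adjacent_count_def)
  next
    case w: (Cons y ys)
    have neq: "x \<noteq> y" and dw: "distinct_adj w"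
      using Cons.prems(1) w by auto
    have mono: "alt_length a b w \<le> alt_length a b (x # w)"
      unfolding alt_length_def by (intro length_remdups_adj_mono subseq_filter) auto
    show ?thesis
    proof (cases "{x, y} = {a, b}")
      case True
      then have "filter (\<lambda>x. x = a \<or> x = b) (x # w) = x # y # filter (\<lambda>x. x = a \<or> x = b) ys"
        "filter (\<lambda>x. x = a \<or> x = b) w = y # filter (\<lambda>x. x = a \<or> x = b) ys"
        using w by auto
      then have "alt_length a b (x # w) = Suc (alt_length a b w)" "alt_length a b w > 0"
        using neq by (auto simp: alt_length_def)
      moreover have "adjacent_count {a, b} (x # w) = Suc (adjacent_count {a, b} w)"
        using True w by (simp add: adjacent_count_def)
      ultimately show ?thesis
        using Cons.IH dw by (cases "adjacent_count {a, b} w > 0") auto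
    next
      case False
      then have "adjacent_count {a, b} (x # w) = adjacent_count {a, b} w"
        using w by (simp add: adjacent_count_def)
      then show ?thesis
        using Cons.IH dw Cons.prems(2) mono by simp
    qed
  qed
qed (simp add: adjacent_count_def)

lemma length_eq_sum_fibres:
  assumes "finite P" "\<And>z. z \<in> set zs \<Longrightarrow> f z \<in> P"
  shows "length zs = (\<Sum>p\<in>P. length (filter (\<lambda>z. f z = p) zs))"
  using assms(2)
proof (induction zs)
  case (Cons z zs)
  have "(\<Sum>p\<in>P. length (filter (\<lambda>z. f z = p) (z # zs)))
      = (\<Sum>p\<in>P. (if f z = p then 1 else 0) + length (filter (\<lambda>z. f z = p) zs))"
    by (intro sum.cong) auto
  also have "\<dots> = Suc (\<Sum>p\<in>P. length (filter (\<lambda>z. f z = p) zs))"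
    using Cons.prems assms(1) by (simp add: sum.distrib)
  finally show ?case using Cons by simp
qed simp

text \<open>
  The neighbouring positions of the word are distributed over the pairs of letters, and each pair
  receives at most \<open>s\<close> of them.
\<close>
lemma davenport_schinzel_length_le:
  assumes "davenport_schinzel s A w" "finite A"
  shows "length w \<le> (card A choose 2) * s + 1"
proof -
  define P where "P = {B. B \<subseteq> A \<and> card B = 2}"
  have adj: "distinct_adj w" and alt: "\<And>a b. a \<noteq> b \<Longrightarrow> alt_length a b w \<le> s + 1"
    using assms(1) by (auto simp: davenport_schinzel_alt_length_iff)
  have pairs: "{x, y} \<in> P" if xy: "(x, y) \<in> set (zip w (tl w))" for x y
  proof -
    obtain i where "x = w ! i" "y = w ! Suc i" "Suc i < length w"
      using xy by (auto simp: in_set_zip nth_tl)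
    moreover from this have "x \<noteq> y"
      using adj by (auto simp: distinct_adj_conv_nth)
    moreover have "set w \<subseteq> A"
      using assms(1) by (simp add: davenport_schinzel_def)
    ultimately show ?thesis
      using nth_mem[of i w] nth_mem[of "Suc i" w] by (auto simp: P_def)
  qed
  have "length (zip w (tl w))
      = (\<Sum>p\<in>P. length (filter (\<lambda>z. (case z of (x, y) \<Rightarrow> {x, y}) = p) (zip w (tl w))))"
    using pairs assms(2) by (intro length_eq_sum_fibres) (auto simp: P_def)
  also have "\<dots> = (\<Sum>p\<in>P. adjacent_count p w)"
    unfolding adjacent_count_def by (intro sum.cong refl arg_cong[where f = length] filter_cong) auto
  also have "\<dots> \<le> (\<Sum>p\<in>P. s)"
  proof (rule sum_mono)
    fix p assume "p \<in> P"
    then obtain a b where "p = {a, b}" "a \<noteq> b"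
      unfolding P_def card_2_iff by blast
    then show "adjacent_count p w \<le> s"
      using adjacent_count_less_alt_length[OF adj, of a b] alt[of a b]
      by (cases "adjacent_count p w > 0") auto
  qed
  also have "\<dots> = (card A choose 2) * s"
    unfolding P_def by (simp add: n_subsets[OF assms(2)])
  finally show ?thesis by simp
qed

text \<open>
  Finiteness is what makes the maximum in \<open>ds_lambda\<close> meaningful; the two lemmas after this one
  are the only access to that maximum.
\<close>
lemma finite_ds_lengths:
  "finite {length w | w :: nat list. davenport_schinzel s {..<m} w}"
  by (rule finite_subset[of _ "{..(m choose 2) * s + 1}"])
     (use davenport_schinzel_length_le[of s "{..<m}"] in auto)

lemma ds_lambda_le: "ds_lambda s m \<le> (m choose 2) * s + 1"
proof -
  have "davenport_schinzel s {..<m} ([] :: nat list)"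
    using not_subseq_length[of "[]"] by (auto simp: davenport_schinzel_def)
  then have "{length w | w :: nat list. davenport_schinzel s {..<m} w} \<noteq> {}"
    by blast
  then show ?thesis
    unfolding ds_lambda_def using finite_ds_lengths davenport_schinzel_length_le[of s "{..<m}"]
    by (subst Max_le_iff) auto
qed

lemma length_le_ds_lambda:
  "davenport_schinzel s {..<m} w \<Longrightarrow> length w \<le> ds_lambda s m"
  unfolding ds_lambda_def using finite_ds_lengths by (intro Max_ge) auto

section \<open>Concatenating words over blocks\<close>

lemma alt_length_append_le:
  "alt_length a b (u @ v) \<le> alt_length a b u + alt_length a b v"
  unfolding alt_length_def by (simp add: length_remdups_adj_append_le)

lemma alt_length_concat_le:
  "alt_length a b (concat ws) \<le> (\<Sum>w\<leftarrow>ws. alt_length a b w)"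
proof (induction ws)
  case (Cons w ws)
  then show ?case using alt_length_append_le[of a b w "concat ws"] by simp
qed (simp add: alt_length_def)

lemma alt_length_le_1:
  assumes "\<not> (a \<in> set w \<and> b \<in> set w)"
  shows "alt_length a b w \<le> 1"
proof -
  define f where "f = filter (\<lambda>x. x = a \<or> x = b) w"
  obtain c where "set f \<subseteq> {c}"
    using assms that[of a] that[of b] unfolding f_def by auto
  then have "f = replicate (length f) c"
    by (metis replicate_length_same singletonD subsetD)
  then have "length (remdups_adj f) \<le> 1"
    by (metis One_nat_def le_refl length_0_conv list.size(3) remdups_adj_replicate zero_le
        length_Cons replicate_empty)
  then show ?thesis by (simp add: alt_length_def f_def)
qed

lemma alt_length_eq_0:
  "a \<notin> set w \<Longrightarrow> b \<notin> set w \<Longrightarrow> alt_length a b w = 0"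
  by (auto simp: alt_length_def filter_empty_conv)

lemma length_remdups_adj_concat_ge:
  assumes "\<And>w. w \<in> set ws \<Longrightarrow> L \<le> length w" "\<And>w. w \<in> set ws \<Longrightarrow> distinct_adj w"
  shows "length ws * (L - 1) \<le> length (remdups_adj (concat ws))"
  using assms
proof (induction ws)
  case (Cons w ws)
  have "L \<le> length (remdups_adj w)"
    using Cons.prems by (simp add: distinct_adj_altdef)
  then show ?case
    using Cons length_remdups_adj_append_ge[of w "concat ws"] by fastforce
qed simp

text \<open>
  For the pair \<open>a, b\<close>, a block that contains only one of the two letters contributes at most \<open>1\<close>,
  and the common block, if there is one, contributes at most \<open>s + 1 \<le> 1 + 1 + s\<close>. Charging \<open>1\<close> to each
  incidence of \<open>a\<close> or \<open>b\<close> with a block leaves a single summand \<open>s\<close>. The blocks must be joined by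
  deleting repetitions at the junctions, which costs one term per block.
\<close>
lemma davenport_schinzel_from_blocks:
  fixes B :: "'i \<Rightarrow> 'a set" and w :: "'i \<Rightarrow> 'a list"
  assumes fin: "finite I"
    and ds: "\<And>i. i \<in> I \<Longrightarrow> davenport_schinzel s (B i) (w i)"
    and sub: "\<And>i. i \<in> I \<Longrightarrow> B i \<subseteq> A"
    and pair: "\<And>a b. a \<noteq> b \<Longrightarrow> card {i \<in> I. a \<in> B i \<and> b \<in> B i} \<le> 1"
    and point: "\<And>a. a \<in> A \<Longrightarrow> card {i \<in> I. a \<in> B i} \<le> r"
    and len: "\<And>i. i \<in> I \<Longrightarrow> L \<le> length (w i)"
  shows "\<exists>v. davenport_schinzel (s + 2 * r) A v \<and> card I * (L - 1) \<le> length v"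
proof -
  obtain js where js: "set js = I" "distinct js"
    using finite_distinct_list[OF fin] by blast
  define u where "u = concat (map w js)"
  have letters: "set (w i) \<subseteq> B i" and adj: "distinct_adj (w i)" if "i \<in> I" for i
    using ds[OF that] by (auto simp: davenport_schinzel_def)
  have point': "card {i \<in> I. a \<in> B i} \<le> r" for a
  proof (cases "a \<in> A")
    case False
    then have "{i \<in> I. a \<in> B i} = {}" using sub by blast
    then show ?thesis by (metis card.empty zero_le)
  qed (use point in blast)
  have alt: "alt_length a b u \<le> s + 2 * r" if "a \<noteq> b" for a b
  proof -
    have "alt_length a b u \<le> (\<Sum>i\<leftarrow>js. alt_length a b (w i))"
      using alt_length_concat_le[of a b "map w js"] by (simp add: u_def comp_def)
    also have "\<dots> = (\<Sum>i\<in>I. alt_length a b (w i))"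
      using js by (simp add: sum_list_distinct_conv_sum_set)
    also have "\<dots> \<le> (\<Sum>i\<in>I. (if a \<in> B i then 1 else 0) + (if b \<in> B i then 1 else 0)
                             + (if a \<in> B i \<and> b \<in> B i then s else 0))"
    proof (rule sum_mono)
      fix i assume i: "i \<in> I"
      have "alt_length a b (w i) \<le> s + 1"
        using ds[OF i] that by (simp add: davenport_schinzel_alt_length_iff)
      then show "alt_length a b (w i) \<le> (if a \<in> B i then 1 else 0) + (if b \<in> B i then 1 else 0)
                             + (if a \<in> B i \<and> b \<in> B i then s else 0)"
        using alt_length_le_1[of a "w i" b] alt_length_eq_0[of a "w i" b] letters[OF i] by auto
    qed
    also have "\<dots> = card {i \<in> I. a \<in> B i} + card {i \<in> I. b \<in> B i}
                    + card {i \<in> I. a \<in> B i \<and> b \<in> B i} * s"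
      using fin by (simp add: sum.distrib sum.If_cases Int_def)
    also have "\<dots> \<le> r + r + 1 * s"
      using pair[OF that] point' by (intro add_mono mult_right_mono) auto
    finally show ?thesis by simp
  qed
  have "davenport_schinzel (s + 2 * r) A (remdups_adj u)"
    unfolding davenport_schinzel_alt_length_iff
  proof (intro conjI allI impI)
    show "set (remdups_adj u) \<subseteq> A"
      using letters sub js by (fastforce simp: u_def)
    show "alt_length a b (remdups_adj u) \<le> s + 2 * r + 1" if "a \<noteq> b" for a b
    proof -
      have "alt_length a b (remdups_adj u) \<le> alt_length a b u"
        unfolding alt_length_def
        by (intro length_remdups_adj_mono subseq_filter subseq_remdups_adj)
      then show ?thesis using alt[OF that] by simp
    qed
  qed simp
  moreover have "card I * (L - 1) \<le> length (remdups_adj u)"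
    using length_remdups_adj_concat_ge[of "map w js" L] len adj js distinct_card[OF js(2)]
    by (auto simp: u_def)
  ultimately show ?thesis by blast
qed

text \<open>
  The blocks are all pairs of letters, so each letter lies in fewer than \<open>card A\<close> of them. An
  alternation of length \<open>s + 1\<close> is too short to contain a forbidden one, and the term lost at the
  junctions turns \<open>s + 1\<close> into \<open>s\<close>.
\<close>
lemma davenport_schinzel_from_pairs:
  fixes A :: "'a set"
  assumes "finite A"
  shows "\<exists>v. davenport_schinzel (s + 2 * card A) A v \<and> (card A choose 2) * s \<le> length v"
proof -
  define I where "I = {P. P \<subseteq> A \<and> card P = 2}"
  have "\<exists>w. davenport_schinzel s P w \<and> s + 1 \<le> length w" if P: "P \<in> I" for P
  proof -
    obtain a b where "P = {a, b}" "a \<noteq> b"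
      using P unfolding I_def card_2_iff by blast
    then have "davenport_schinzel s P (alternation a b (s + 1))"
      using set_alternation distinct_adj_alternation
      by (fastforce simp: davenport_schinzel_def)
    then show ?thesis by (metis length_alternation order_refl)
  qed
  then obtain w where w: "\<And>P. P \<in> I \<Longrightarrow> davenport_schinzel s P (w P) \<and> s + 1 \<le> length (w P)"
    by metis
  have "finite I" using assms by (simp add: I_def)
  moreover have "card {P \<in> I. a \<in> P \<and> b \<in> P} \<le> 1" if "a \<noteq> b" for a b
  proof -
    have "{P \<in> I. a \<in> P \<and> b \<in> P} \<subseteq> {{a, b}}"
      using that by (auto simp: I_def card_2_iff)
    from card_mono[OF _ this] show ?thesis by simp
  qed
  moreover have "card {P \<in> I. a \<in> P} \<le> card A" for a
  proof -
    have "{P \<in> I. a \<in> P} \<subseteq> (\<lambda>x. {a, x}) ` A"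
      by (auto simp: I_def card_2_iff)
    then have "card {P \<in> I. a \<in> P} \<le> card ((\<lambda>x. {a, x}) ` A)"
      using assms by (intro card_mono) auto
    also have "\<dots> \<le> card A" using assms by (rule card_image_le)
    finally show ?thesis .
  qed
  ultimately have "\<exists>v. davenport_schinzel (s + 2 * card A) A v \<and> card I * (s + 1 - 1) \<le> length v"
    using w by (intro davenport_schinzel_from_blocks[where B = "\<lambda>P. P" and w = w]) (auto simp: I_def)
  then show ?thesis
    using n_subsets[OF assms, of 2] by (simp add: I_def)
qed

section \<open>Finite fields of characteristic two\<close>

text \<open>
  The polynomial splits into linear factors, and a repeated factor would make the derivative
  vanish at the corresponding root.
\<close>
lemma card_roots_of_separable:
  fixes p :: "'a :: alg_closed_field poly"
  assumes "p \<noteq> 0" "\<And>x. poly p x = 0 \<Longrightarrow> poly (pderiv p) x \<noteq> 0"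
  shows "card {x. poly p x = 0} = degree p"
proof -
  obtain R where R: "size R = degree p" "p = smult (lead_coeff p) (\<Prod>x\<in>#R. [:-x, 1:])"
    using alg_closed_imp_factorization[OF assms(1)] by blast
  have root: "poly p x = 0 \<longleftrightarrow> x \<in># R" for x
    using assms(1) by (subst R(2)) (auto simp: poly_prod_mset prod_mset_zero_iff)
  have "count R x \<le> 1" for x
  proof (rule ccontr)
    assume "\<not> ?thesis"
    then have "x \<in># R" "x \<in># R - {#x#}"
      by (auto simp flip: count_greater_zero_iff)
    then obtain S where "R = add_mset x (add_mset x S)"
      by (metis multi_member_split add_mset_remove_trivial)
    then obtain g where g: "p = [:-x, 1:] * ([:-x, 1:] * g)"
      using that[of "smult (lead_coeff p) (\<Prod>x\<in>#S. [:-x, 1:])"] R(2)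
      by (simp only: image_mset_add_mset prod_mset.add_mset mult_smult_right)
    have "poly p x = 0" "poly (pderiv p) x = 0"
      by (simp_all only: g pderiv_mult poly_add poly_mult poly_pCons poly_0 mult_zero_right add_0_right mult_1_right
         add.left_inverse mult_zero_left)
    then show False using assms(2) by blast
  qed
  then have "count R x = count (mset_set (set_mset R)) x" for x
    using count_greater_eq_one_iff[of R x] by (cases "x \<in># R") (auto simp: not_in_iff intro: le_antisym)
  then have "R = mset_set (set_mset R)" by (rule multiset_eqI)
  then have "size R = card (set_mset R)"
    using size_mset_set[of "set_mset R"] by simp
  then show ?thesis using R(1) root by simp
qed

text \<open>
  The set \<open>K\<close> consists of the roots of \<open>X^q - X\<close> with \<open>q = 2 ^ j\<close>. It is closed under addition
  because the map \<open>x \<mapsto> x^q\<close> is additive in characteristic two, and it has \<open>q\<close> elements because the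
  derivative of the polynomial is the constant \<open>-1\<close>. Closure under these two operations is all that
  the design asks of \<open>K\<close>.
\<close>
lemma exists_finite_field_power_of_two:
  assumes "j > 0"
  shows "\<exists>K :: bit alg_closure set. card K = 2 ^ j \<and>
           (\<forall>x\<in>K. \<forall>y\<in>K. x + y \<in> K \<and> x * y \<in> K)"
proof -
  define q :: nat where "q = 2 ^ j"
  define p :: "bit alg_closure poly" where "p = monom 1 q - monom 1 1"
  have two: "(2 :: bit alg_closure) = 0"
    by (metis bit_2_eq_0 to_ac_0 to_ac_numeral)
  have q: "q > 1" using one_less_power[of "2::nat" j] assms by (simp add: q_def)
  have frob: "(x + y) ^ q = x ^ q + y ^ q" for x y :: "bit alg_closure"
    unfolding q_def
  proof (induction j)
    case (Suc j)
    have "(x + y) ^ 2 ^ Suc j = (x ^ 2 ^ j + y ^ 2 ^ j)\<^sup>2"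
      using Suc by (metis power_Suc2 power_mult)
    then show ?case
      using two by (simp add: power2_sum power_Suc2 power_mult del: power_Suc)
  qed simp
  have deg: "degree p = q"
    unfolding p_def diff_conv_add_uminus using q
    by (subst degree_add_eq_left) (auto simp: degree_monom_eq)
  have "card {x. poly p x = 0} = degree p"
  proof (rule card_roots_of_separable)
    show "p \<noteq> 0" using deg q by auto
    have "(of_nat q :: bit alg_closure) = 0"
      using assms two by (simp add: q_def)
    then show "poly (pderiv p) x \<noteq> 0" for x
      by (simp add: p_def pderiv_diff pderiv_monom)
  qed
  then have "card {x :: bit alg_closure. x ^ q = x} = 2 ^ j"
    using deg by (simp add: p_def poly_monom q_def)
  moreover have "x + y \<in> {x. x ^ q = x} \<and> x * y \<in> {x. x ^ q = x}"
    if "x \<in> {x. x ^ q = x}" "y \<in> {x. x ^ q = x}" for x y :: "bit alg_closure"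
    using that frob[of x y] by (simp add: power_mult_distrib)
  ultimately show ?thesis by blast
qed

section \<open>A transversal design from lines\<close>

text \<open>
  A number \<open>x < k * q\<close> stands for the point with coordinates \<open>x div q\<close> and \<open>x mod q\<close>, both read as
  field elements through an enumeration \<open>e\<close> of \<open>K\<close>. The blocks are the lines that are not vertical,
  restricted to the first \<open>k\<close> columns. Such a line meets every column once, and two points determine
  at most one of them. Through a point there is at most one line for each slope.
\<close>
lemma exists_transversal_design:
  fixes K :: "'f :: field set"
  assumes K: "card K = q" "\<forall>x\<in>K. \<forall>y\<in>K. x + y \<in> K \<and> x * y \<in> K"
    and q0: "q > 0" and "k \<le> q"
  shows "\<exists>B :: 'f \<times> 'f \<Rightarrow> nat set. \<exists>I. finite I \<and> card I = q\<^sup>2 \<and>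
     (\<forall>i\<in>I. B i \<subseteq> {..<k * q} \<and> card (B i) = k) \<and>
     (\<forall>x y. x \<noteq> y \<longrightarrow> card {i \<in> I. x \<in> B i \<and> y \<in> B i} \<le> 1) \<and>
     (\<forall>x. card {i \<in> I. x \<in> B i} \<le> q)"
proof -
  have finK: "finite K"
    using K(1) q0 by (intro card_ge_0_finite) simp
  obtain e where e: "bij_betw e {..<q} K"
    using finK K(1) by (metis bij_betw_iff_card card_lessThan finite_lessThan)
  have eK: "e i \<in> K" if "i < q" for i
    using e that by (auto simp: bij_betw_def)
  have inj: "e i = e i' \<longleftrightarrow> i = i'" if "i < q" "i' < q" for i i'
    using e that by (auto simp: bij_betw_def inj_on_def)
  define B where "B = (\<lambda>(a, b). {x. x < k * q \<and> e (x mod q) = a * e (x div q) + b})"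
  have divq: "x div q < k" "x div q < q" if "x < k * q" for x
    using less_mult_imp_div_less[OF that] \<open>k \<le> q\<close> by simp_all
  have block: "card (B i) = k" if "i \<in> K \<times> K" for i
  proof -
    obtain a b where i: "i = (a, b)" "a \<in> K" "b \<in> K" using \<open>i \<in> K \<times> K\<close> by blast
    have "bij_betw (\<lambda>x. x div q) (B i) {..<k}"
      unfolding bij_betw_def
    proof
      show "inj_on (\<lambda>x. x div q) (B i)"
      proof (rule inj_onI)
        fix x y assume "x \<in> B i" "y \<in> B i" and eq: "x div q = y div q"
        then have "e (x mod q) = e (y mod q)" by (auto simp: B_def i)
        then have "x mod q = y mod q" using inj q0 by simp
        with eq show "x = y" by (metis div_mult_mod_eq)
      qed
      have "c \<in> (\<lambda>x. x div q) ` B i" if "c < k" for c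
      proof -
        have "a * e c + b \<in> K" using K(2) i eK[of c] that \<open>k \<le> q\<close> by simp
        then have "a * e c + b \<in> e ` {..<q}"
          using bij_betw_imp_surj_on[OF e] by simp
        then obtain y where y: "y < q" "e y = a * e c + b"
          by auto
        have "c * q + y < Suc c * q" using y by simp
        also have "\<dots> \<le> k * q" using that by (intro mult_right_mono) auto
        finally have "c * q + y \<in> B i" using y by (simp add: B_def i)
        moreover have "(c * q + y) div q = c" using y by simp
        ultimately show ?thesis by (metis imageI)
      qed
      moreover have "(\<lambda>x. x div q) ` B i \<subseteq> {..<k}"
        using divq by (auto simp: B_def i)
      ultimately show "(\<lambda>x. x div q) ` B i = {..<k}" by blast
    qed
    then show ?thesis using bij_betw_same_card by fastforce
  qed
  have pair: "card {i \<in> K \<times> K. x \<in> B i \<and> y \<in> B i} \<le> 1" if "x \<noteq> y" for x y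
  proof -
    have "i = i'" if "i \<in> K \<times> K" "x \<in> B i" "y \<in> B i" "i' \<in> K \<times> K" "x \<in> B i'" "y \<in> B i'" for i i'
    proof -
      obtain a b a' b' where i: "i = (a, b)" "i' = (a', b')" by fastforce
      define ex ey where "ex = e (x div q)" and "ey = e (y div q)"
      have xy: "x < k * q" "y < k * q" and
        eqs: "e (x mod q) = a * ex + b" "e (y mod q) = a * ey + b"
             "e (x mod q) = a' * ex + b'" "e (y mod q) = a' * ey + b'"
        using that by (auto simp: B_def i ex_def ey_def)
      \<comment> \<open>Two points in the same column and on the same line have both coordinates equal.\<close>
      have "ex \<noteq> ey"
      proof
        assume "ex = ey"
        then have "x div q = y div q" "e (x mod q) = e (y mod q)"
          using inj divq xy eqs by (auto simp: ex_def ey_def)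
        then show False using inj q0 \<open>x \<noteq> y\<close> by (metis div_mult_mod_eq mod_less_divisor)
      qed
      moreover have "a * (ex - ey) = a' * (ex - ey)"
      proof -
        have "a * (ex - ey) = e (x mod q) - e (y mod q)"
          by (simp add: eqs(1,2) right_diff_distrib)
        also have "\<dots> = a' * (ex - ey)"
          by (simp add: eqs(3,4) right_diff_distrib)
        finally show ?thesis .
      qed
      ultimately have "a = a'" by simp
      then show ?thesis using eqs i by simp
    qed
    moreover have "finite {i \<in> K \<times> K. x \<in> B i \<and> y \<in> B i}"
      using finK by simp
    ultimately show ?thesis
      unfolding One_nat_def by (simp add: card_le_Suc0_iff_eq del: mem_Sigma_iff)
  qed
  have point: "card {i \<in> K \<times> K. x \<in> B i} \<le> q" for x
  proof -
    have "{i \<in> K \<times> K. x \<in> B i} \<subseteq> (\<lambda>a. (a, e (x mod q) - a * e (x div q))) ` K"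
      by (auto simp: B_def)
    then have "card {i \<in> K \<times> K. x \<in> B i} \<le> card ((\<lambda>a. (a, e (x mod q) - a * e (x div q))) ` K)"
      using finK by (intro card_mono) auto
    also have "\<dots> \<le> q" using card_image_le[OF finK] K(1) by metis
    finally show ?thesis .
  qed
  show ?thesis
  proof (intro exI[of _ B] exI[of _ "K \<times> K"] conjI ballI allI impI)
    show "card (K \<times> K) = q\<^sup>2" using K(1) by (simp add: power2_eq_square card_cartesian_product)
    show "finite (K \<times> K)" using finK by simp
    show "B i \<subseteq> {..<k * q}" for i by (auto simp: B_def split: prod.split)
  qed (fact block pair point)+
qed

section \<open>The lower bound and the limit\<close>

lemma real_choose_two: "real (n choose 2) = real n * (real n - 1) / 2"
  by (induction n) (auto simp: numeral_2_eq_2 field_simps)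

lemma exists_power_of_two_near_sqrt:
  assumes "m \<ge> 2"
  shows "\<exists>j>0. sqrt (real m) \<le> 2 ^ j \<and> 2 ^ j \<le> 2 * sqrt (real m)"
proof -
  define j where "j = (LEAST j. m \<le> 4 ^ j)"
  have "\<exists>j. m \<le> 4 ^ j"
    using less_exp[of m] power_mono[of "2::nat" 4 m] by (intro exI[of _ m]) linarith
  then have j: "m \<le> 4 ^ j"
    unfolding j_def by (rule LeastI_ex)
  then have "j > 0" using assms by (cases j) auto
  then have "\<not> m \<le> 4 ^ (j - 1)"
    unfolding j_def by (intro not_less_Least) simp
  then have "4 ^ j \<le> 4 * m"
    using \<open>j > 0\<close> by (cases j) auto
  have "real m \<le> (2 ^ j)\<^sup>2" "(2 ^ j)\<^sup>2 \<le> 4 * real m"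
  proof -
    have eq: "((2::real) ^ j)\<^sup>2 = real (4 ^ j)"
      by (simp add: power2_eq_square flip: power_mult_distrib)
    show "real m \<le> (2 ^ j)\<^sup>2" using j unfolding eq of_nat_le_iff .
    show "(2 ^ j)\<^sup>2 \<le> 4 * real m" using \<open>4 ^ j \<le> 4 * m\<close> unfolding eq by linarith
  qed
  then have "sqrt (real m) \<le> 2 ^ j" "2 ^ j \<le> 2 * sqrt (real m)"
    using real_le_rsqrt[of "2 ^ j" "4 * real m"] by (auto intro: real_le_lsqrt simp: real_sqrt_mult)
  with \<open>j > 0\<close> show ?thesis by blast
qed

text \<open>
  Each block of the design carries the word built from all its pairs; in the order,
  \<open>2 * k\<close> pays for the pairs inside a block, and \<open>2 * q\<close> for the \<open>q\<close> blocks through a point.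
\<close>
lemma ds_lambda_ge_transversal:
  fixes K :: "'f :: field set"
  assumes K: "card K = q" "\<forall>x\<in>K. \<forall>y\<in>K. x + y \<in> K \<and> x * y \<in> K"
    and "q > 0" "k \<le> q" "k * q \<le> m"
  shows "q\<^sup>2 * ((k choose 2) * s - 1) \<le> ds_lambda (s + 2 * k + 2 * q) m"
proof -
  obtain B :: "'f \<times> 'f \<Rightarrow> nat set" and I
    where I: "finite I" "card I = q\<^sup>2"
      and B: "\<forall>i\<in>I. B i \<subseteq> {..<k * q} \<and> card (B i) = k"
      and pair: "\<forall>x y. x \<noteq> y \<longrightarrow> card {i \<in> I. x \<in> B i \<and> y \<in> B i} \<le> 1"
      and point: "\<forall>x. card {i \<in> I. x \<in> B i} \<le> q"
    using exists_transversal_design[OF K \<open>q > 0\<close> \<open>k \<le> q\<close>] by (elim exE conjE) (rule that)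
  have "\<exists>w. davenport_schinzel (s + 2 * k) (B i) w \<and> (k choose 2) * s \<le> length w" if "i \<in> I" for i
  proof -
    have "finite (B i)" "card (B i) = k"
      using B that finite_subset[OF _ finite_lessThan] by blast+
    then show ?thesis using davenport_schinzel_from_pairs[of "B i" s] by simp
  qed
  then obtain w where w: "\<And>i. i \<in> I \<Longrightarrow> davenport_schinzel (s + 2 * k) (B i) (w i)"
    "\<And>i. i \<in> I \<Longrightarrow> (k choose 2) * s \<le> length (w i)"
    by metis
  have "\<exists>v. davenport_schinzel (s + 2 * k + 2 * q) {..<m} v \<and> card I * ((k choose 2) * s - 1) \<le> length v"
  proof (rule davenport_schinzel_from_blocks[where B = B and w = w])
    show "B i \<subseteq> {..<m}" if "i \<in> I" for i
    proof -
      have "B i \<subseteq> {..<k * q}" using B that by blast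
      then show ?thesis using \<open>k * q \<le> m\<close> by auto
    qed
    show "card {i \<in> I. x \<in> B i \<and> y \<in> B i} \<le> 1" if "x \<noteq> y" for x y
      using pair that by simp
    show "card {i \<in> I. x \<in> B i} \<le> q" for x
      using point by simp
  qed (fact I w)+
  then obtain v where v: "davenport_schinzel (s + 2 * k + 2 * q) {..<m} v"
    and len: "q\<^sup>2 * ((k choose 2) * s - 1) \<le> length v"
    unfolding I(2) by blast
  show ?thesis
    using len length_le_ds_lambda[OF v] by (rule order.trans)
qed

text \<open>
  Here \<open>q\<close> is a power of two with \<open>R \<le> q \<le> 2 * R\<close>, and \<open>k = m div q\<close>. From \<open>q \<ge> R\<close> comes \<open>k \<le> q\<close>, as
  the design requires. From \<open>q \<le> 2 * R\<close> come the three factors: at most \<open>2 * R\<close> letters remain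
  outside the design, another \<open>2 * R\<close> stems from \<open>k - 1\<close> in place of \<open>k\<close> in the binomial coefficient, and
  the order drops by \<open>2 * k + 2 * q \<le> 8 * R\<close>. The last term pays for the junctions of the \<open>q\<^sup>2\<close> blocks.
\<close>
lemma ds_lambda_ge_real:
  assumes "R = sqrt (real m)" "R \<ge> 4" "real s \<ge> 8 * R"
  shows "(R\<^sup>2 - 2 * R) * (R\<^sup>2 - 4 * R) * (real s - 8 * R) / 2 - 4 * R\<^sup>2 \<le> real (ds_lambda s m)"
proof -
  have R2: "R\<^sup>2 = real m" using assms(1) by simp
  have "4 ^ 2 \<le> R\<^sup>2" using assms(2) by (intro power_mono) auto
  then have "m \<ge> 2" using R2 by simp
  then obtain j where j: "j > 0" "R \<le> 2 ^ j" "2 ^ j \<le> 2 * R"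
    using exists_power_of_two_near_sqrt assms(1) by blast
  define q :: nat where "q = 2 ^ j"
  obtain K :: "bit alg_closure set" where K: "card K = q"
    "\<forall>x\<in>K. \<forall>y\<in>K. x + y \<in> K \<and> x * y \<in> K"
    using exists_finite_field_power_of_two[OF j(1)] unfolding q_def by blast
  define k where "k = m div q"
  have q: "R \<le> real q" "real q \<le> 2 * R" "q > 0" using j by (auto simp: q_def)
  have "real m \<le> real q * real q"
    using mult_mono[OF q(1) q(1)] R2 assms(2) by (simp add: power2_eq_square)
  then have "m \<le> q * q" by (metis of_nat_le_iff of_nat_mult)
  then have kq: "k \<le> q"
    unfolding k_def by (metis div_le_mono nonzero_mult_div_cancel_right q(3) less_not_refl2)
  have km: "k * q \<le> m" by (simp add: k_def)
  have "m < k * q + q"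
    using q(3) by (metis add.commute add_less_cancel_left div_mult_mod_eq k_def mod_less_divisor)
  then have "real m \<le> real k * real q + real q"
    by (metis less_imp_le of_nat_add of_nat_le_iff of_nat_mult)
  then have kq_ge: "R\<^sup>2 - 2 * R \<le> real k * real q" "R\<^sup>2 - 4 * R \<le> real k * real q - real q"
    using R2 q by linarith+
  have nonneg: "0 \<le> R\<^sup>2 - 4 * R" "0 \<le> R\<^sup>2 - 2 * R"
    using assms(2) by (auto simp: power2_eq_square mult_right_mono)
  have k_real: "real k \<le> real q" using kq by simp
  have s: "2 * k + 2 * q \<le> s"
    using k_real q assms(3) by linarith
  define t where "t = s - 2 * k - 2 * q"
  have t: "real s - 8 * R \<le> real t" using s k_real q by (simp add: t_def of_nat_diff)
  have ch: "real (k choose 2) = real k * (real k - 1) / 2"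
    by (rule real_choose_two)
  have "(R\<^sup>2 - 2 * R) * (R\<^sup>2 - 4 * R) * (real s - 8 * R)
      \<le> (real k * real q) * (real k * real q - real q) * real t"
    using nonneg kq_ge t assms(3) by (intro mult_mono) auto
  also have "\<dots> = 2 * (real q)\<^sup>2 * (real (k choose 2) * real t)"
    unfolding ch by (simp add: power2_eq_square algebra_simps)
  finally have "(R\<^sup>2 - 2 * R) * (R\<^sup>2 - 4 * R) * (real s - 8 * R) / 2 - 4 * R\<^sup>2
      \<le> (real q)\<^sup>2 * (real (k choose 2) * real t) - (real q)\<^sup>2"
    using power_mono[OF q(2), of 2] by (simp add: power_mult_distrib)
  also have "\<dots> = (real q)\<^sup>2 * (real ((k choose 2) * t) - 1)"
    by (simp add: algebra_simps)
  also have "\<dots> \<le> (real q)\<^sup>2 * real ((k choose 2) * t - 1)"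
    by (intro mult_left_mono) (linarith, simp)
  also have "\<dots> = real (q\<^sup>2 * ((k choose 2) * t - 1))" by simp
  also have "\<dots> \<le> real (ds_lambda s m)"
    using ds_lambda_ge_transversal[OF K q(3) kq km, of t] s
    unfolding of_nat_le_iff by (simp add: t_def)
  finally show ?thesis .
qed

text \<open>
  The denominator \<open>R\<^sup>2 * R\<^sup>2 / 2 * S\<close> with \<open>R\<^sup>2 = m\<close> is an upper bound for \<open>(m choose 2) * S\<close>. In this form
  every correction tends to zero under the hypotheses of the theorem.
\<close>
lemma lower_bound_quotient:
  fixes R S :: real
  assumes "R > 0" "S > 0"
  shows "((R\<^sup>2 - 2 * R) * (R\<^sup>2 - 4 * R) * (S - 8 * R) / 2 - 4 * R\<^sup>2) / (R\<^sup>2 * R\<^sup>2 / 2 * S)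
      = (1 - 2 / R) * (1 - 4 / R) * (1 - 8 * (R / S)) - 8 / (R\<^sup>2 * S)"
proof -
  have "(R\<^sup>2 - 2 * R) * (R\<^sup>2 - 4 * R) * (S - 8 * R) / 2 / (R\<^sup>2 * R\<^sup>2 / 2 * S)
      = ((R\<^sup>2 - 2 * R) / R\<^sup>2) * ((R\<^sup>2 - 4 * R) / R\<^sup>2) * ((S - 8 * R) / S)"
    unfolding times_divide_times_eq by simp
  also have "\<dots> = (1 - 2 / R) * (1 - 4 / R) * (1 - 8 * (R / S))"
    using assms by (simp add: diff_divide_distrib power2_eq_square)
  finally have "(R\<^sup>2 - 2 * R) * (R\<^sup>2 - 4 * R) * (S - 8 * R) / 2 / (R\<^sup>2 * R\<^sup>2 / 2 * S)
      = (1 - 2 / R) * (1 - 4 / R) * (1 - 8 * (R / S))" .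
  moreover have "4 * R\<^sup>2 / (R\<^sup>2 * R\<^sup>2 / 2 * S) = 8 / (R\<^sup>2 * S)"
    using assms by (simp add: power2_eq_square)
  ultimately show ?thesis by (simp only: diff_divide_distrib)
qed

theorem theorem4:
  fixes s m :: "nat \<Rightarrow> nat"
  assumes "\<And>n. n \<ge> 1 \<Longrightarrow> s n \<ge> 1"
    and "\<And>n. n \<ge> 1 \<Longrightarrow> m n \<ge> 1"
    and "filterlim s at_top at_top"
    and "filterlim m at_top at_top"
    and "filterlim (\<lambda>n. real (s n) / sqrt (real (m n))) at_top at_top"
  shows "(\<lambda>n. real (ds_lambda (s n) (m n)) / (real (m n choose 2) * real (s n))) \<longlonglongrightarrow> 1"
proof -
  define R where "R n = sqrt (real (m n))" for n
  define S where "S n = real (s n)" for n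
  define low where "low n = (1 - 2 / R n) * (1 - 4 / R n) * (1 - 8 * (R n / S n)) - 8 / ((R n)\<^sup>2 * S n)" for n
  define up where "up n = 1 + 1 / S n" for n
  have S: "filterlim S at_top sequentially"
    unfolding S_def using assms(3) filterlim_compose filterlim_real_sequentially by blast
  have R: "filterlim R at_top sequentially"
    unfolding R_def using assms(4) filterlim_compose[OF sqrt_at_top]
      filterlim_compose[OF filterlim_real_sequentially] by blast
  have SR: "filterlim (\<lambda>n. S n / R n) at_top sequentially"
    using assms(5) by (simp add: S_def R_def)
  have inv_S: "(\<lambda>n. inverse (S n)) \<longlonglongrightarrow> 0" and inv_R: "(\<lambda>n. inverse (R n)) \<longlonglongrightarrow> 0"
    and "(\<lambda>n. inverse (S n / R n)) \<longlonglongrightarrow> 0"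
    using S R SR tendsto_inverse_0_at_top by blast+
  then have R_over_S: "(\<lambda>n. R n / S n) \<longlonglongrightarrow> 0" by simp
  have "up \<longlonglongrightarrow> 1 + 0"
    unfolding up_def divide_inverse mult_1_left by (intro tendsto_intros inv_S)
  then have up: "up \<longlonglongrightarrow> 1" by simp
  have "low = (\<lambda>n. (1 - 2 * inverse (R n)) * (1 - 4 * inverse (R n)) * (1 - 8 * (R n / S n))
               - 8 * ((inverse (R n))\<^sup>2 * inverse (S n)))"
    by (simp add: low_def fun_eq_iff divide_inverse power_inverse)
  moreover have "\<dots> \<longlonglongrightarrow> (1 - 2 * 0) * (1 - 4 * 0) * (1 - 8 * 0) - 8 * (0\<^sup>2 * 0)"
    by (intro tendsto_intros inv_S inv_R R_over_S)
  ultimately have low: "low \<longlonglongrightarrow> 1" by simp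
  \<comment> \<open>These are the ranges in which \<open>ds_lambda_ge_real\<close> applies and no denominator vanishes.\<close>
  have ev: "eventually (\<lambda>n. R n \<ge> 4 \<and> S n \<ge> 1 \<and> S n / R n \<ge> 8) sequentially"
    using R S SR by (auto simp: filterlim_at_top eventually_conj_iff)
  show ?thesis
  proof (rule tendsto_sandwich[OF _ _ low up]; rule eventually_mono[OF ev])
    fix n assume n: "R n \<ge> 4 \<and> S n \<ge> 1 \<and> S n / R n \<ge> 8"
    define C where "C = real (m n choose 2)"
    have R2: "(R n)\<^sup>2 = real (m n)" by (simp add: R_def)
    have "4 ^ 2 \<le> (R n)\<^sup>2" using n by (intro power_mono) auto
    then have "m n \<ge> 2" using R2 by simp
    then have C1: "C \<ge> 1" unfolding C_def by (simp add: Suc_le_eq zero_less_binomial)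
    have C2: "C \<le> (R n)\<^sup>2 * (R n)\<^sup>2 / 2"
      unfolding C_def R2 real_choose_two by (simp add: mult_left_mono)
    have CS: "0 < C * S n" using C1 n by simp
    have pos: "R n > 0" "S n > 0" using n by linarith+
    have R4: "R n \<ge> 4" using n by simp
    have S8: "S n \<ge> 8 * R n" using n pos(1) by (simp add: pos_le_divide_eq)
    have "low n = (((R n)\<^sup>2 - 2 * R n) * ((R n)\<^sup>2 - 4 * R n) * (S n - 8 * R n) / 2 - 4 * (R n)\<^sup>2)
        / ((R n)\<^sup>2 * (R n)\<^sup>2 / 2 * S n)"
      by (simp only: low_def lower_bound_quotient[OF pos])
    also have "\<dots> \<le> real (ds_lambda (s n) (m n)) / ((R n)\<^sup>2 * (R n)\<^sup>2 / 2 * S n)"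
    proof (rule divide_right_mono)
      show "((R n)\<^sup>2 - 2 * R n) * ((R n)\<^sup>2 - 4 * R n) * (S n - 8 * R n) / 2 - 4 * (R n)\<^sup>2
          \<le> real (ds_lambda (s n) (m n))"
        using ds_lambda_ge_real[OF R_def R4 S8[unfolded S_def]] by (simp only: S_def)
    qed (use pos in simp)
    also have "\<dots> \<le> real (ds_lambda (s n) (m n)) / (C * S n)"
      using C2 C1 pos by (intro divide_left_mono mult_right_mono mult_pos_pos) auto
    finally show "low n \<le> real (ds_lambda (s n) (m n)) / (real (m n choose 2) * real (s n))"
      by (simp add: C_def S_def)
    have "real (ds_lambda (s n) (m n)) \<le> C * S n + 1"
      using of_nat_mono[OF ds_lambda_le[of "s n" "m n"], where 'a = real] by (simp add: C_def S_def)
    then have "real (ds_lambda (s n) (m n)) / (C * S n) \<le> (C * S n + 1) / (C * S n)"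
      using CS by (intro divide_right_mono) auto
    also have "\<dots> = 1 + 1 / (C * S n)" using C1 pos by (simp add: add_divide_distrib)
    also have "\<dots> \<le> up n"
      unfolding up_def using mult_right_mono[OF C1, of "S n"] pos
      by (intro add_left_mono frac_le) auto
    finally show "real (ds_lambda (s n) (m n)) / (real (m n choose 2) * real (s n)) \<le> up n"
      by (simp add: C_def S_def)
  qed
qed

end
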